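(* Let $\mathcal{C}$ be a finite set of classes. Let $\phi_{nc}$ denote the conditional probability of class $c\in\mathcal{C}$ given sample $n$ for a Model A, of the form $$\phi_{nc}=p(y=c\mid n)=\frac{p(n\mid y=c)\,p(y=c)}{p(n)},$$ where $p(y=c)>0$ is the class probability distribution of Model A, $p(n)>0$ is the marginal probability of $n$, and $p(n\mid y=c)$ is the class-conditional density. Let $\hat\phi_{nc}$ denote the conditional probability for a Model B trained on the same data, of the form $$\hat\phi_{nc}=\hat p(y=c\mid n)=\frac{p(n\mid y=c)\,\hat p(y=c)}{p(n)},$$ where $\hat p(y=c)>0$ is the class probability distribution associated with Model B, and $p(n\mid y=c)$ and $p(n)$ are the same as for Model A. Assume that Models A and B share the same architecture and parameters, so that they produce identical real logits $z_{nc}$ for each sample $n$ and class $c$. If $\phi_{nc}$ is expressed by the standard softmax function, $\phi_{nc}=e^{z_{nc}}/\sum_{d\in\mathcal{C}}e^{z_{nd}}$, and Model A classifies samples via $\operatorname{argmax}_{c}z_{nc}$, then $$\hat\phi_{nc}=\frac{\frac{\hat p(y=c)}{p(y=c)}e^{z_{nc}}}{\sum_{d\in\mathcal{C}}\frac{\hat p(y=d)}{p(y=d)}e^{z_{nd}}}$$ for every sample $n$ and class $c$, and Model B classifies samples via $$\operatorname*{argmax}_{c}\left(z_{nc}+\log\frac{\hat p(y=c)}{p(y=c)}\right).$$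
   Context: For each sample $n$, both $(\phi_{nc})_{c\in\mathcal{C}}$ and $(\hat\phi_{nc})_{c\in\mathcal{C}}$ are probability distributions over $\mathcal{C}$ (nonnegative, summing to $1$). A model classifies a sample $n$ by choosing a class with the largest conditional probability; for Model A this is $\operatorname{argmax}_c z_{nc}$, and for Model B it means $\operatorname{argmax}_c\hat\phi_{nc}$. *)

theory Defs
  imports "HOL-Probability.Probability"
begin

definition prob_distribution_on :: "'c set \<Rightarrow> ('c \<Rightarrow> real) \<Rightarrow> bool" where
  "prob_distribution_on C q \<longleftrightarrow> (\<forall>c\<in>C. 0 \<le> q c) \<and> (\<Sum>c\<in>C. q c) = 1"

text \<open>The reference measure is arbitrary, so that discrete samples (counting measure)
  and continuous ones (Lebesgue measure) are both covered.\<close>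

definition prob_density :: "'s measure \<Rightarrow> ('s \<Rightarrow> real) \<Rightarrow> bool" where
  "prob_density M f \<longleftrightarrow> f \<in> borel_measurable M \<and> (\<forall>x\<in>space M. 0 \<le> f x) \<and>
     prob_space (density M (\<lambda>x. ennreal (f x)))"

definition bayes_posterior ::
  "('s \<Rightarrow> 'c \<Rightarrow> real) \<Rightarrow> ('c \<Rightarrow> real) \<Rightarrow> ('s \<Rightarrow> real) \<Rightarrow> 's \<Rightarrow> 'c \<Rightarrow> real" where
  "bayes_posterior lik prior marg n c = lik n c * prior c / marg n"

definition softmax :: "'c set \<Rightarrow> ('c \<Rightarrow> real) \<Rightarrow> 'c \<Rightarrow> real" where
  "softmax C z c = exp (z c) / (\<Sum>d\<in>C. exp (z d))"

text \<open>The argmax is the set of all maximisers, since ties are possible.\<close>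

definition argmax_on :: "'c set \<Rightarrow> ('c \<Rightarrow> real) \<Rightarrow> 'c set" where
  "argmax_on C f = {c. is_arg_max f (\<lambda>c. c \<in> C) c}"

text \<open>The classes that a model with conditional class probabilities \<open>\<phi>\<close> may assign
  to the sample \<open>n\<close>.\<close>

definition classification :: "'c set \<Rightarrow> ('s \<Rightarrow> 'c \<Rightarrow> real) \<Rightarrow> 's \<Rightarrow> 'c set" where
  "classification C \<phi> n = argmax_on C (\<phi> n)"

end

theory Submission imports Defs
begin

text \<open>By Bayes' rule with a common likelihood and marginal, the posteriors of the two models
  differ by the prior ratio, so \<open>\<phi>'\<close> is proportional to the reweighted exponentials. Since
  \<open>\<phi>'\<close> sums to one, the constant of proportionality is forced. The logarithm of the
  reweighted exponential is the shifted logit, so both have the same maximisers.\<close>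

text \<open>\<open>is_arg_max\<close> consults a function only through strict comparisons between
  elements of \<open>C\<close>, so agreement on these fixes the set of maximisers, ties
  included.\<close>

lemma argmax_on_cong_less:
  fixes f g :: "'c \<Rightarrow> real"
  assumes "\<And>c d. c \<in> C \<Longrightarrow> d \<in> C \<Longrightarrow> f c < f d \<longleftrightarrow> g c < g d"
  shows "argmax_on C f = argmax_on C g"
  using assms unfolding argmax_on_def is_arg_max_def by blast

text \<open>Summing the proportionality over \<open>C\<close> gives \<open>1\<close> on one side and
  the total weight over \<open>S\<close> on the other, which identifies \<open>S\<close>.\<close>

lemma prob_distribution_on_proportional:
  assumes "prob_distribution_on C q" and "\<And>c. c \<in> C \<Longrightarrow> q c = w c / S" and "c \<in> C"
  shows "q c = w c / (\<Sum>d\<in>C. w d)"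
proof -
  have "(\<Sum>d\<in>C. w d) / S = (\<Sum>d\<in>C. q d)"
    using assms(2) by (simp add: sum_divide_distrib)
  also have "\<dots> = 1"
    using assms(1) by (simp add: prob_distribution_on_def)
  finally have "S = (\<Sum>d\<in>C. w d)"
    \<comment> \<open>Division by zero yields \<open>0\<close>, so \<open>S = 0\<close> would turn
      the equation into \<open>0 = 1\<close>.\<close>
    by (cases "S = 0") auto
  then show ?thesis
    using assms(2,3) by simp
qed

lemma bayes_posterior_change_prior:
  assumes "p c \<noteq> 0"
  shows "bayes_posterior lik p' marg n c = p' c / p c * bayes_posterior lik p marg n c"
  using assms by (simp add: bayes_posterior_def)

text \<open>Both \<open>exp\<close> and division by a positive constant are strictly increasing, so
  they preserve strict comparisons. Any positive \<open>S\<close> will do, whether or not it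
  normalises \<open>q\<close>.\<close>

lemma argmax_on_reweighted_exp:
  fixes z r :: "'c \<Rightarrow> real"
  assumes "0 < S" and "\<And>c. c \<in> C \<Longrightarrow> 0 < r c"
    and "\<And>c. c \<in> C \<Longrightarrow> q c = r c * exp (z c) / S"
  shows "argmax_on C q = argmax_on C (\<lambda>c. z c + ln (r c))"
proof (rule argmax_on_cong_less)
  \<comment> \<open>Since \<open>r c\<close> is positive, \<open>exp (ln (r c)) = r c\<close>, and
    the weight moves into the exponent.\<close>
  have q: "q c = exp (z c + ln (r c)) / S" if "c \<in> C" for c
    using assms that by (simp add: exp_add mult.commute)
  show "q c < q d \<longleftrightarrow> z c + ln (r c) < z d + ln (r d)" if "c \<in> C" "d \<in> C" for c d
    using that \<open>0 < S\<close> by (simp only: q divide_less_cancel exp_less_cancel_iff) simp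
qed

theorem theorem4p1:
  fixes C :: "'c set"
    and M :: "'s measure"
    and N :: "'s set"
    and lik :: "'s \<Rightarrow> 'c \<Rightarrow> real"
    and p p' :: "'c \<Rightarrow> real"
    and marg :: "'s \<Rightarrow> real"
    and \<phi> \<phi>' :: "'s \<Rightarrow> 'c \<Rightarrow> real"
    and z :: "'s \<Rightarrow> 'c \<Rightarrow> real"
  assumes finite_classes: "finite C"
    and samples: "N \<subseteq> space M"
    and class_densities: "\<And>c. c \<in> C \<Longrightarrow> prob_density M (\<lambda>n. lik n c)"
    and prior_A: "prob_distribution_on C p" "\<And>c. c \<in> C \<Longrightarrow> 0 < p c"
    and prior_B: "prob_distribution_on C p'" "\<And>c. c \<in> C \<Longrightarrow> 0 < p' c"
    and marginal: "\<And>n. n \<in> N \<Longrightarrow> marg n = (\<Sum>c\<in>C. lik n c * p c)"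
    and marginal_pos: "\<And>n. n \<in> N \<Longrightarrow> 0 < marg n"
    and bayes_A: "\<And>n c. n \<in> N \<Longrightarrow> c \<in> C \<Longrightarrow> \<phi> n c = bayes_posterior lik p marg n c"
    and bayes_B: "\<And>n c. n \<in> N \<Longrightarrow> c \<in> C \<Longrightarrow> \<phi>' n c = bayes_posterior lik p' marg n c"
    and distribution_A: "\<And>n. n \<in> N \<Longrightarrow> prob_distribution_on C (\<phi> n)"
    and distribution_B: "\<And>n. n \<in> N \<Longrightarrow> prob_distribution_on C (\<phi>' n)"
    and softmax_A: "\<And>n c. n \<in> N \<Longrightarrow> c \<in> C \<Longrightarrow> \<phi> n c = softmax C (z n) c"
    and classification_A: "\<And>n. n \<in> N \<Longrightarrow> classification C \<phi> n = argmax_on C (z n)"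
  shows "(\<forall>n\<in>N. \<forall>c\<in>C. \<phi>' n c =
            (p' c / p c * exp (z n c)) / (\<Sum>d\<in>C. p' d / p d * exp (z n d))) \<and>
         (\<forall>n\<in>N. classification C \<phi>' n = argmax_on C (\<lambda>c. z n c + ln (p' c / p c)))"
proof -
  have "(\<forall>c\<in>C. \<phi>' n c = (p' c / p c * exp (z n c)) / (\<Sum>d\<in>C. p' d / p d * exp (z n d))) \<and>
      classification C \<phi>' n = argmax_on C (\<lambda>c. z n c + ln (p' c / p c))" if n: "n \<in> N" for n
  proof -
    define S where "S = (\<Sum>d\<in>C. exp (z n d))"
    \<comment> \<open>An empty sum is \<open>0\<close>, not \<open>1\<close>; nonemptiness makes the
      sum of exponentials strictly positive.\<close>
    have "C \<noteq> {}"
      using prior_A(1) by (auto simp: prob_distribution_on_def)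
    then have "0 < S"
      unfolding S_def using finite_classes by (intro sum_pos) auto
    \<comment> \<open>Here \<open>S\<close> is still the softmax normaliser of Model A. Being
      positive and the same for all classes, it serves both conclusions below.\<close>
    have \<phi>': "\<phi>' n c = p' c / p c * exp (z n c) / S" if c: "c \<in> C" for c
    proof -
      have "\<phi>' n c = p' c / p c * \<phi> n c"
        using bayes_posterior_change_prior[of p c lik p' marg n] prior_A(2)[OF c]
        by (simp add: bayes_A[OF n c] bayes_B[OF n c])
      then show ?thesis
        by (simp add: softmax_A[OF n c] softmax_def S_def)
    qed
    have "\<phi>' n c = (p' c / p c * exp (z n c)) / (\<Sum>d\<in>C. p' d / p d * exp (z n d))"
      if "c \<in> C" for c
      by (rule prob_distribution_on_proportional[OF distribution_B[OF n] \<phi>' that])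
    moreover have "classification C \<phi>' n = argmax_on C (\<lambda>c. z n c + ln (p' c / p c))"
      unfolding classification_def
      by (rule argmax_on_reweighted_exp[OF \<open>0 < S\<close> _ \<phi>'])
        (simp_all add: prior_A(2) prior_B(2))
    ultimately show ?thesis by blast
  qed
  then show ?thesis by blast
qed

end
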